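(* (1) Let $\Gamma$ be an infinite cardinal number with $\Gamma^\omega=\Gamma$ and let $1\leq p<\infty$. Then $\ell_p(\Gamma)$ contains a subgroup that is $2^{1/p}$-separated and $1$-dense. Furthermore, if $p>1$, the ($1$-dense) subgroup can be chosen to be $(2^{1/p}+)$-separated. (2) Let $\mathcal{X}$ be an infinite-dimensional normed space. Then for every $\varepsilon>0$ there exists a subgroup $\mathcal{D}$ of $\mathcal{X}$ that is $1$-separated and $(1+\varepsilon)$-dense. Furthermore, the group $\mathcal{D}$ is generated by a set of vectors of norm at most $2+\varepsilon$.
   Context: All normed spaces are over the real field; subgroups are subgroups of the additive group of the space. $\Gamma^\omega$ denotes cardinal exponentiation (the cardinality of the set of all sequences with values in $\Gamma$). $\ell_p(\Gamma)$ carries its canonical norm. Let $\mathcal{D}$ be a subset of a normed space $\mathcal{X}$ and $r>0$. $\mathcal{D}$ is $r$-separated (respectively, $(r+)$-separated) if $\|d-h\|\geq r$ (respectively, $\|d-h\|>r$) for all distinct $d,h\in\mathcal{D}$. $\mathcal{D}$ is $r$-dense if for every $x\in\mathcal{X}$ there is $d\in\mathcal{D}$ with $\|x-d\|\leq r$. *)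

theory Defs
  imports
    "HOL-Analysis.Analysis"
    "HOL-Library.Function_Algebras"
    "HOL-Computational_Algebra.Group_Closure"
begin

unbundle cardinal_syntax

(* A normed space is passed to the following notions as a carrier X together with a norm N.
   This covers both a type of class real_normed_vector (carrier UNIV, norm) and the spaces
   l_p(Gamma), which depend on the real number p and hence do not form a single type. *)

definition add_subgroup :: "'a::ab_group_add set \<Rightarrow> 'a set \<Rightarrow> bool" where
  "add_subgroup X D \<longleftrightarrow>
     D \<subseteq> X \<and> 0 \<in> D \<and> (\<forall>d\<in>D. \<forall>h\<in>D. d + h \<in> D) \<and> (\<forall>d\<in>D. - d \<in> D)"

definition separated :: "('a::ab_group_add \<Rightarrow> real) \<Rightarrow> real \<Rightarrow> 'a set \<Rightarrow> bool" where
  "separated N r D \<longleftrightarrow> (\<forall>d\<in>D. \<forall>h\<in>D. d \<noteq> h \<longrightarrow> N (d - h) \<ge> r)"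

definition separated_plus :: "('a::ab_group_add \<Rightarrow> real) \<Rightarrow> real \<Rightarrow> 'a set \<Rightarrow> bool" where
  "separated_plus N r D \<longleftrightarrow> (\<forall>d\<in>D. \<forall>h\<in>D. d \<noteq> h \<longrightarrow> N (d - h) > r)"

definition dense_within :: "('a::ab_group_add \<Rightarrow> real) \<Rightarrow> 'a set \<Rightarrow> real \<Rightarrow> 'a set \<Rightarrow> bool" where
  "dense_within N X r D \<longleftrightarrow> (\<forall>x\<in>X. \<exists>d\<in>D. N (x - d) \<le> r)"

definition infinite_dimensional :: "'a::real_vector set \<Rightarrow> bool" where
  "infinite_dimensional V \<longleftrightarrow> (\<nexists>B. finite B \<and> B \<subseteq> V \<and> V \<subseteq> span B)"

(* A cardinal is a well-order Gamma with Card_order Gamma; its underlying index set is Field Gamma.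
   The sequences indexed by it are total functions vanishing outside Field Gamma. *)

definition lp_space :: "real \<Rightarrow> 'g rel \<Rightarrow> ('g \<Rightarrow> real) set" where
  "lp_space p \<Gamma> = {x. (\<forall>i. i \<notin> Field \<Gamma> \<longrightarrow> x i = 0) \<and>
                     (\<lambda>i. \<bar>x i\<bar> powr p) summable_on Field \<Gamma>}"

definition lp_norm :: "real \<Rightarrow> 'g rel \<Rightarrow> ('g \<Rightarrow> real) \<Rightarrow> real" where
  "lp_norm p \<Gamma> x = (\<Sum>\<^sub>\<infinity>i\<in>Field \<Gamma>. \<bar>x i\<bar> powr p) powr (1 / p)"

end

theory Submission
  imports Defs
begin

text \<open>
  Both groups are generated by vectors \<open>x + u\<close>, where \<open>x\<close> runs through a well-ordered dense family
  all of whose initial segments have fewer elements than any set with dense span, and \<open>u\<close> is a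
  vector of norm (almost) \<open>1\<close> that is nearly orthogonal to \<open>x\<close> and to all earlier generators. Then \<open>x\<close>
  is within the required distance of the new generator.
  In \<open>\<ell>\<^sub>p(\<Gamma>)\<close> one takes for \<open>u\<close> the unit vector of a coordinate at which \<open>x\<close> and the earlier
  generators vanish, and adds \<open>x + u\<close> only if \<open>x\<close> is farther than \<open>1\<close> from the group built so far:
  a new element \<open>d + n (x + u)\<close> satisfies
  \<open>\<parallel>d + n (x + u)\<parallel>\<^sup>p = \<parallel>d + n x\<parallel>\<^sup>p + \<bar>n\<bar>\<^sup>p\<close>, which exceeds \<open>2\<close> if \<open>\<bar>n\<bar> = 1\<close> and is at least
  \<open>2\<^sup>p\<close> otherwise. In a general normed space \<open>u\<close> comes from Riesz' lemma, and restricting \<open>x\<close> to a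
  ball of radius slightly larger than \<open>1\<close> bounds the generators and still suffices for density.
\<close>

section \<open>Groups generated by transfinite recursion\<close>

lemma group_closure_mono: "S \<subseteq> T \<Longrightarrow> group_closure S \<subseteq> group_closure T"
proof
  fix z assume "z \<in> group_closure S" "S \<subseteq> T"
  then show "z \<in> group_closure T"
    by induction (auto intro: group_closure.intros)
qed

lemma group_closure_finitary:
  assumes "z \<in> group_closure T"
  shows "\<exists>F. finite F \<and> F \<subseteq> T \<and> z \<in> group_closure F"
  using assms
proof induction
  case (base s)
  then show ?case
    by (intro exI[of _ "{s} \<inter> T"]) (auto intro: group_closure.base)
next
  case (diff s t)
  then obtain F F' where "finite F" "F \<subseteq> T" "s \<in> group_closure F"
    and "finite F'" "F' \<subseteq> T" "t \<in> group_closure F'" by blast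
  then show ?case
    using group_closure_mono[of F "F \<union> F'"] group_closure_mono[of F' "F \<union> F'"]
    by (intro exI[of _ "F \<union> F'"]) (auto intro!: group_closure.diff)
qed

text \<open>The additive map \<open>c\<close> plays the role of the integer multiples of
  \<open>g\<close>. It is a parameter because each application supplies its own formula for them,
  pointwise in one case and by \<open>scaleR\<close> in the other.\<close>

lemma group_closure_insertE:
  fixes c :: "int \<Rightarrow> 'a::ab_group_add"
  assumes "z \<in> group_closure (insert g T)"
    and c: "\<And>m n. c (m - n) = c m - c n" "c 1 = g"
  obtains d n where "d \<in> group_closure T" "z = d + c n"
proof -
  have c0: "c 0 = 0" using c(1)[of 0 0] by simp
  from assms(1) have "\<exists>d n. d \<in> group_closure T \<and> z = d + c n"
  proof induction
    case (base s)
    then consider "s = g" | "s \<in> insert 0 T" by blast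
    then show ?case
    proof cases
      case 1
      then show ?thesis
        by (intro exI[of _ 0] exI[of _ 1]) (simp add: c(2))
    next
      case 2
      then show ?thesis
        by (intro exI[of _ s] exI[of _ 0]) (auto simp: c0 intro: group_closure.base)
    qed
  next
    case (diff s t)
    then obtain d n d' n' where "d \<in> group_closure T" "s = d + c n"
      "d' \<in> group_closure T" "t = d' + c n'" by blast
    then show ?case
      by (intro exI[of _ "d - d'"] exI[of _ "n - n'"]) (auto simp: c(1) intro: group_closure.diff)
  qed
  then show ?thesis using that by blast
qed

lemma add_subgroup_group_closure:
  "group_closure T \<subseteq> X \<Longrightarrow> add_subgroup X (group_closure T)"
  by (simp add: add_subgroup_def group_closure_add)

text \<open>One generator is chosen for each point of \<open>X\<close>, along a well-order in which
  every proper initial segment is smaller than \<open>X\<close>; hence the cardinality hypothesis in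
  \<open>step\<close>. Limit stages are harmless because each element of a generated group involves
  only finitely many generators.\<close>

lemma transfinite_generators:
  fixes C B :: "'b::ab_group_add set" and X :: "'a set"
  assumes "0 \<in> C"
    and step: "\<And>T x. x \<in> X \<Longrightarrow> |T| <o |X| \<Longrightarrow> T \<subseteq> B \<Longrightarrow> group_closure T \<subseteq> C \<Longrightarrow>
      \<exists>g\<in>B. group_closure (insert g T) \<subseteq> C \<and> (\<exists>d\<in>group_closure (insert g T). near x d)"
  obtains T where "T \<subseteq> B" "group_closure T \<subseteq> C" "\<And>x. x \<in> X \<Longrightarrow> \<exists>d\<in>group_closure T. near x d"
proof -
  define r where "r = |X|"
  have Card: "Card_order r" and Field: "Field r = X" and wo: "Well_order r"
    by (simp_all add: r_def Field_card_of card_of_card_order_on card_of_well_order_on)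
  have wf: "wf (r - Id)" using wo by (simp add: well_order_on_def)
  have lin: "(x, y) \<in> r \<or> (y, x) \<in> r" if "x \<in> X" "y \<in> X" for x y
    using wo that Field
    by (cases "x = y") (auto simp: well_order_on_def linear_order_on_def partial_order_on_def
        preorder_on_def total_on_def refl_on_def)
  have tr: "trans r"
    using wo by (auto simp: well_order_on_def linear_order_on_def partial_order_on_def preorder_on_def)
  have sub: "underS r x \<subseteq> X" for x
    using Field by (auto simp: underS_def Field_def)
  \<comment> \<open>\<open>Q f x g\<close>: \<open>g\<close> is an admissible choice at
    \<open>x\<close>, given the values of \<open>f\<close> strictly below \<open>x\<close>. The
    guard \<open>x \<in> X\<close> makes the choice vacuous elsewhere, since the recursion runs over
    the whole type.\<close>
  define Q where "Q f x g \<longleftrightarrow> x \<in> X \<longrightarrow> g \<in> B \<and>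
      group_closure (insert g (f ` underS r x)) \<subseteq> C \<and>
      (\<exists>d\<in>group_closure (insert g (f ` underS r x)). near x d)" for f :: "'a \<Rightarrow> 'b" and x g
  have finite_bound: "\<exists>y\<in>F. F \<subseteq> insert y (underS r y)" if "finite F" "F \<noteq> {}" "F \<subseteq> X" for F
    using that
  proof (induction rule: finite_ne_induct)
    case (insert x F)
    then obtain y where y: "y \<in> F" "F \<subseteq> insert y (underS r y)" by auto
    show ?case
    proof (cases "(x, y) \<in> r")
      case True
      then show ?thesis using y by (intro bexI[of _ y]) (auto simp: underS_def)
    next
      case False
      then have "(y, x) \<in> r" using lin[of x y] insert y by auto
      then show ?thesis using y tr False
        by (intro bexI[of _ x]) (auto simp: underS_def dest: transD)
    qed
  qed simp
  \<comment> \<open>The finitely many generators involved have a largest index \<open>y\<close>, so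
    the element already lies in the group formed at stage \<open>y\<close>. If none is involved, the
    element is 0.\<close>
  have union: "group_closure (f ` Y) \<subseteq> C"
    if Y: "Y \<subseteq> X" and IH: "\<And>y. y \<in> Y \<Longrightarrow> Q f y (f y)" for f Y
  proof
    fix z assume "z \<in> group_closure (f ` Y)"
    then obtain F where F: "finite F" "F \<subseteq> f ` Y" "z \<in> group_closure F"
      using group_closure_finitary by blast
    then obtain G where G: "finite G" "G \<subseteq> Y" "F = f ` G"
      using finite_subset_image by metis
    show "z \<in> C"
    proof (cases "G = {}")
      case True
      then show ?thesis using F G \<open>0 \<in> C\<close> by simp
    next
      case False
      then obtain y where y: "y \<in> G" "G \<subseteq> insert y (underS r y)"
        using finite_bound[of G] G Y by blast
      then have "F \<subseteq> insert (f y) (f ` underS r y)" using G by blast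
      then have "z \<in> group_closure (insert (f y) (f ` underS r y))"
        using F(3) group_closure_mono by blast
      then show ?thesis using IH[of y] y G Y unfolding Q_def by blast
    qed
  qed
  have "\<exists>f. \<forall>x. Q f x (f x)"
  proof (rule dependent_wf_choice[OF wf])
    fix f g :: "'a \<Rightarrow> 'b" and x b
    assume "\<And>z. (z, x) \<in> r - Id \<Longrightarrow> f z = g z"
    then have "f ` underS r x = g ` underS r x" by (force simp: underS_def)
    then show "Q f x b = Q g x b" by (simp add: Q_def)
  next
    fix x and f :: "'a \<Rightarrow> 'b"
    assume IH: "\<And>y. (y, x) \<in> r - Id \<Longrightarrow> Q f y (f y)"
    then have IH': "Q f y (f y)" if "y \<in> underS r x" for y
      using that by (auto simp: underS_def)
    show "\<exists>b. Q f x b"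
    proof (cases "x \<in> X")
      case True
      have "|f ` underS r x| <o |X|"
        using card_of_image[of f "underS r x"] card_of_underS[OF Card] True Field ordLeq_ordLess_trans
        unfolding r_def by blast
      moreover have "f ` underS r x \<subseteq> B"
        using IH' sub unfolding Q_def by blast
      moreover have "group_closure (f ` underS r x) \<subseteq> C"
        using union[OF sub IH'] .
      ultimately show ?thesis
        using step[OF True, of "f ` underS r x"] unfolding Q_def by blast
    qed (simp add: Q_def)
  qed
  then obtain f where f: "\<And>x. Q f x (f x)" by blast
  show ?thesis
  proof
    show "f ` X \<subseteq> B" using f by (auto simp: Q_def)
    show "group_closure (f ` X) \<subseteq> C" using union[of X f] f by blast
    fix x assume x: "x \<in> X"
    have "insert (f x) (f ` underS r x) \<subseteq> f ` X" using sub x by blast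
    then show "\<exists>d\<in>group_closure (f ` X). near x d"
      using f[of x] x group_closure_mono unfolding Q_def by blast
  qed
qed

section \<open>The spaces \<open>\<ell>\<^sub>p(\<Gamma>)\<close>\<close>

lemma lp_space_scale:
  assumes "x \<in> lp_space p \<Gamma>"
  shows "(\<lambda>i. c * x i) \<in> lp_space p \<Gamma>"
proof -
  have "(\<lambda>i. \<bar>c\<bar> powr p * \<bar>x i\<bar> powr p) summable_on Field \<Gamma>"
    using assms by (intro summable_on_cmult_right) (simp add: lp_space_def)
  then show ?thesis using assms by (simp add: lp_space_def abs_mult powr_mult)
qed

text \<open>Summability follows from the crude pointwise bound
  \<open>\<bar>a + b\<bar> \<le> 2 * max \<bar>a\<bar> \<bar>b\<bar>\<close>.\<close>

lemma lp_space_add: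
  assumes "x \<in> lp_space p \<Gamma>" "y \<in> lp_space p \<Gamma>" "p \<ge> 0"
  shows "x + y \<in> lp_space p \<Gamma>"
proof -
  have le: "\<bar>x i + y i\<bar> powr p \<le> 2 powr p * (\<bar>x i\<bar> powr p + \<bar>y i\<bar> powr p)" for i
  proof -
    have "\<bar>x i + y i\<bar> powr p \<le> (2 * max \<bar>x i\<bar> \<bar>y i\<bar>) powr p"
      using assms(3) by (intro powr_mono2) auto
    also have "\<dots> = 2 powr p * max \<bar>x i\<bar> \<bar>y i\<bar> powr p"
      by (simp add: powr_mult)
    also have "\<dots> \<le> 2 powr p * (\<bar>x i\<bar> powr p + \<bar>y i\<bar> powr p)"
      by (auto simp: max_def)
    finally show ?thesis .
  qed
  have "(\<lambda>i. 2 powr p * (\<bar>x i\<bar> powr p + \<bar>y i\<bar> powr p)) summable_on Field \<Gamma>"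
    using assms unfolding lp_space_def by (auto intro!: summable_on_cmult_right summable_on_add)
  then have "(\<lambda>i. \<bar>x i + y i\<bar> powr p) summable_on Field \<Gamma>"
    by (rule summable_on_comparison_test) (use le in auto)
  then show ?thesis using assms unfolding lp_space_def by auto
qed

lemma lp_space_unit_vector:
  assumes "j \<in> Field \<Gamma>"
  shows "(\<lambda>i. of_bool (i = j)) \<in> lp_space p \<Gamma>"
proof -
  have "(\<lambda>i. \<bar>of_bool (i = j) :: real\<bar> powr p) summable_on {j}" by simp
  then have "(\<lambda>i. \<bar>of_bool (i = j) :: real\<bar> powr p) summable_on Field \<Gamma>"
    by (rule summable_on_cong_neutral[THEN iffD1, rotated -1]) (use assms in auto)
  then show ?thesis using assms by (auto simp: lp_space_def)
qed

lemma countable_support_lp_space: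
  assumes "x \<in> lp_space p \<Gamma>"
  shows "countable {i. x i \<noteq> 0}"
proof -
  have "{i. x i \<noteq> 0} = {i\<in>Field \<Gamma>. \<bar>x i\<bar> powr p \<noteq> 0}"
    using assms by (auto simp: lp_space_def)
  then show ?thesis
    using assms summable_countable_real unfolding lp_space_def by fastforce
qed

text \<open>The p-th power of the norm is additive over disjoint supports; splitting off the term at
  \<open>j\<close> shows this.\<close>

lemma infsum_powr_add_unit:
  fixes y :: "'g \<Rightarrow> real"
  assumes "y \<in> lp_space p \<Gamma>" "j \<in> Field \<Gamma>" "y j = 0"
  shows "(\<Sum>\<^sub>\<infinity>i\<in>Field \<Gamma>. \<bar>y i + t * of_bool (i = j)\<bar> powr p) =
    (\<Sum>\<^sub>\<infinity>i\<in>Field \<Gamma>. \<bar>y i\<bar> powr p) + \<bar>t\<bar> powr p"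
proof -
  let ?A = "Field \<Gamma> - {j}"
  have s: "(\<lambda>i. \<bar>y i\<bar> powr p) summable_on ?A"
    using assms unfolding lp_space_def by (auto intro: summable_on_subset)
  have eq: "\<bar>y i + t * of_bool (i = j)\<bar> powr p = \<bar>y i\<bar> powr p" if "i \<in> ?A" for i
    using that by auto
  have s': "(\<lambda>i. \<bar>y i + t * of_bool (i = j)\<bar> powr p) summable_on ?A"
    by (rule summable_on_cong[THEN iffD2, OF eq s])
  have split: "infsum f (Field \<Gamma>) = f j + infsum f ?A" if "f summable_on ?A" for f :: "'g \<Rightarrow> real"
    using infsum_insert[OF that, of j] unfolding insert_Diff[OF assms(2)] by simp
  have "(\<Sum>\<^sub>\<infinity>i\<in>?A. \<bar>y i + t * of_bool (i = j)\<bar> powr p) = (\<Sum>\<^sub>\<infinity>i\<in>?A. \<bar>y i\<bar> powr p)"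
    by (rule infsum_cong) (rule eq)
  then show ?thesis
    unfolding split[OF s] split[OF s'] using assms(3) by simp
qed

section \<open>Cardinality and fresh coordinates\<close>

text \<open>Rational lower cuts on the support code a vector by a nonempty countable subset of a set
  equinumerous with \<Gamma>. Such subsets are ranges of sequences, and there are only \<Gamma> many
  sequences.\<close>

lemma card_lp_space:
  assumes "Card_order \<Gamma>" "infinite (Field \<Gamma>)" "\<Gamma> ^c natLeq =o \<Gamma>"
  shows "|lp_space p (\<Gamma> :: 'g rel)| \<le>o \<Gamma>"
proof -
  let ?G = "Field \<Gamma>"
  obtain j where j: "j \<in> ?G" using assms(2) by fastforce
  \<comment> \<open>A countable subset of \<open>?G \<times> \<rat>\<close> that determines \<open>x\<close>; the coordinate \<open>j\<close> keeps it nonempty,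
    so that it is the range of a sequence.\<close>
  define A where "A x = {(i, q :: rat). (i = j \<or> x i \<noteq> 0) \<and> of_rat q < x i}" for x :: "'g \<Rightarrow> real"
  have rats: "\<exists>q. real_of_rat q < a" for a :: real
    using of_rat_dense[of "a - 1" a] by auto
  have inj: "inj_on A (lp_space p \<Gamma>)"
  proof (rule inj_onI, rule ext)
    fix x y i assume eq: "A x = A y"
    then have *: "(i = j \<or> x i \<noteq> 0) \<and> of_rat q < x i \<longleftrightarrow> (i = j \<or> y i \<noteq> 0) \<and> of_rat q < y i" for q
      unfolding A_def by (auto simp: set_eq_iff)
    show "x i = y i"
    proof (cases "i = j \<or> x i \<noteq> 0 \<and> y i \<noteq> 0")
      case True
      then have **: "of_rat q < x i \<longleftrightarrow> of_rat q < y i" for q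
        using *[of q] by blast
      show ?thesis
      proof (rule ccontr)
        assume "x i \<noteq> y i"
        then consider "x i < y i" | "y i < x i" by linarith
        then show False
        proof cases
          case 1
          then show ?thesis using of_rat_dense[of "x i" "y i"] ** less_asym by blast
        next
          case 2
          then show ?thesis using of_rat_dense[of "y i" "x i"] ** less_asym by blast
        qed
      qed
    next
      case False
      \<comment> \<open>If only one of the two values were nonzero, a rational below it would give a
        pair at \<open>i\<close> in just one of the codes. So both vanish.\<close>
      then have "x i \<noteq> 0 \<longleftrightarrow> y i \<noteq> 0" using * rats[of "x i"] rats[of "y i"] by blast
      then show ?thesis using False by auto
    qed
  qed
  have "|UNIV :: rat set| \<le>o |UNIV :: nat set|"
    using inj_to_nat card_of_ordLeq by blast
  also have "|UNIV :: nat set| \<le>o |?G|"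
    using assms(2) infinite_iff_card_of_nat by blast
  finally have "|?G \<times> (UNIV :: rat set)| =o |?G|"
    using assms(2) by (intro card_of_Times_infinite_simps) auto
  then obtain \<phi> where \<phi>: "bij_betw \<phi> ?G (?G \<times> (UNIV :: rat set))"
    using card_of_ordIso[of ?G "?G \<times> (UNIV :: rat set)"] ordIso_symmetric by blast
  have "A x \<in> (\<lambda>s. \<phi> ` range s) ` Func (UNIV :: nat set) ?G" if x: "x \<in> lp_space p \<Gamma>" for x
  proof -
    have "A x \<subseteq> insert j {i. x i \<noteq> 0} \<times> UNIV" by (auto simp: A_def)
    moreover have "countable (insert j {i. x i \<noteq> 0} \<times> (UNIV :: rat set))"
      using countable_support_lp_space[OF x] by simp
    ultimately have c: "countable (A x)" by (rule countable_subset)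
    have ne: "A x \<noteq> {}" using rats[of "x j"] by (auto simp: A_def)
    have sub: "A x \<subseteq> \<phi> ` ?G"
      using x j \<phi> by (auto simp: A_def bij_betw_def lp_space_def)
    define s where "s n = inv_into ?G \<phi> (from_nat_into (A x) n)" for n
    have "from_nat_into (A x) n \<in> \<phi> ` ?G" for n
      using from_nat_into[OF ne] sub by blast
    then have "s n \<in> ?G" "\<phi> (s n) = from_nat_into (A x) n" for n
      unfolding s_def by (auto intro: inv_into_into f_inv_into_f)
    then have "s \<in> Func UNIV ?G" "\<phi> ` range s = A x"
      using range_from_nat_into[OF ne c] by (auto simp: Func_def image_image)
    then show ?thesis by blast
  qed
  then have "|A ` lp_space p \<Gamma>| \<le>o |(\<lambda>s. \<phi> ` range s) ` Func (UNIV :: nat set) ?G|"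
    by (intro card_of_mono1) blast
  moreover have "|lp_space p \<Gamma>| \<le>o |A ` lp_space p \<Gamma>|"
    using inj card_of_ordLeq by blast
  moreover have "|Func (UNIV :: nat set) ?G| =o \<Gamma>"
    using assms(3) by (simp add: cexp_def Field_natLeq)
  ultimately show ?thesis
    using card_of_image[of "\<lambda>s. \<phi> ` range s" "Func (UNIV :: nat set) ?G"]
    by (blast intro: ordLeq_transitive ordLeq_ordIso_trans)
qed

text \<open>Cantor's theorem: \<omega> is smaller than 2 to the power \<omega>, which is at most
  \<Gamma> to the power \<omega>. Uncountability keeps fewer than \<Gamma> countable supports from
  covering \<Gamma>.\<close>

lemma uncountable_if_cexp_natLeq:
  assumes "Card_order \<Gamma>" "infinite (Field \<Gamma>)" "\<Gamma> ^c natLeq =o \<Gamma>"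
  shows "|UNIV :: nat set| <o \<Gamma>"
proof -
  have "natLeq \<le>o \<Gamma>"
    using assms by (intro natLeq_ordLeq_cinfinite) (auto simp: cinfinite_def)
  moreover have "ctwo \<le>o natLeq"
    by (metis ctwo_ordLeq_Cinfinite natLeq_Cinfinite)
  ultimately have "ctwo ^c natLeq \<le>o \<Gamma> ^c natLeq"
    using cexp_mono1 natLeq_Card_order ordLeq_transitive by blast
  then have "natLeq <o \<Gamma>"
    using ordLess_ctwo_cexp[OF natLeq_Card_order] assms(3) ordLess_ordLeq_trans ordLeq_ordIso_trans
    by metis
  then show ?thesis
    using card_of_nat ordIso_ordLess_trans by blast
qed

lemma exists_fresh_coordinate:
  assumes "Card_order \<Gamma>" "|UNIV :: nat set| <o \<Gamma>" "|T| <o \<Gamma>"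
    and "\<And>x. x \<in> T \<Longrightarrow> countable {i. x i \<noteq> (0 :: real)}"
  obtains j where "j \<in> Field \<Gamma>" "\<And>x. x \<in> T \<Longrightarrow> x j = 0"
proof -
  have FG: "|Field \<Gamma>| =o \<Gamma>" using assms(1) card_of_Field_ordIso by blast
  have inf: "infinite (Field \<Gamma>)"
    using ordLeq_ordIso_trans[OF ordLess_imp_ordLeq[OF assms(2)] ordIso_symmetric[OF FG]]
      infinite_iff_card_of_nat by blast
  \<comment> \<open>The disjoint sum is an infinite bound for both the number of supports and the
    size of each, even if \<open>T\<close> is finite, and it is still below \<Gamma>.\<close>
  let ?B = "T <+> (UNIV :: nat set)"
  have B: "|?B| <o \<Gamma>"
    using card_of_Plus_ordLess_infinite_Field[OF inf assms(1,3,2)] .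
  have infB: "infinite ?B" by simp
  have natB: "|UNIV :: nat set| \<le>o |?B|" by (rule card_of_Plus2)
  have "|\<Union>x\<in>T. {i. x i \<noteq> 0}| \<le>o |?B|"
  proof (rule card_of_UNION_ordLeq_infinite[OF infB])
    show "|T| \<le>o |?B|" by (rule card_of_Plus1)
    show "\<forall>x\<in>T. |{i. x i \<noteq> 0}| \<le>o |?B|"
    proof
      fix x assume "x \<in> T"
      then have "\<exists>f. inj_on f {i. x i \<noteq> 0} \<and> f ` {i. x i \<noteq> 0} \<subseteq> (UNIV :: nat set)"
        using assms(4) unfolding countable_def by blast
      then have "|{i. x i \<noteq> 0}| \<le>o |UNIV :: nat set|"
        using card_of_ordLeq by blast
      then show "|{i. x i \<noteq> 0}| \<le>o |?B|" using natB ordLeq_transitive by blast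
    qed
  qed
  then have "|\<Union>x\<in>T. {i. x i \<noteq> 0}| <o |Field \<Gamma>|"
    by (rule ordLess_ordIso_trans[OF ordLeq_ordLess_trans[OF _ B] ordIso_symmetric[OF FG]])
  then have "\<not> Field \<Gamma> \<subseteq> (\<Union>x\<in>T. {i. x i \<noteq> 0})"
    using card_of_mono1[of "Field \<Gamma>" "\<Union>x\<in>T. {i. x i \<noteq> 0}"] not_ordLess_ordLeq by blast
  then show ?thesis using that by blast
qed

section \<open>The subgroup of the sequence space\<close>

lemma lp_subgroup:
  fixes \<Gamma> :: "'g rel"
  assumes \<Gamma>: "Card_order \<Gamma>" "infinite (Field \<Gamma>)" "\<Gamma> ^c natLeq =o \<Gamma>" and p: "1 \<le> p"
  obtains D where "add_subgroup (lp_space p \<Gamma>) D"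
    "separated (lp_norm p \<Gamma>) (2 powr (1 / p)) D"
    "p > 1 \<Longrightarrow> separated_plus (lp_norm p \<Gamma>) (2 powr (1 / p)) D"
    "dense_within (lp_norm p \<Gamma>) (lp_space p \<Gamma>) 1 D"
proof -
  let ?L = "lp_space p \<Gamma>"
  define S where "S x = (\<Sum>\<^sub>\<infinity>i\<in>Field \<Gamma>. \<bar>x i\<bar> powr p)" for x :: "'g \<Rightarrow> real"
  have S_ge0: "S x \<ge> 0" for x unfolding S_def by (rule infsum_nonneg) simp
  have norm_S: "lp_norm p \<Gamma> x = S x powr (1 / p)" for x by (simp add: lp_norm_def S_def)
  \<comment> \<open>Both separation claims, raised to the power p, are built into \<open>C\<close>,
    so that a single group serves for both.\<close>
  define C where "C = {z \<in> ?L. z = 0 \<or> S z \<ge> 2 \<and> (p > 1 \<longrightarrow> S z > 2)}"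
  have "0 \<in> C" by (simp add: C_def lp_space_def)
  obtain T where T: "group_closure T \<subseteq> C"
    "\<And>x. x \<in> ?L \<Longrightarrow> \<exists>d\<in>group_closure T. lp_norm p \<Gamma> (x - d) \<le> 1"
  proof (rule transfinite_generators[of C ?L UNIV "\<lambda>x d. lp_norm p \<Gamma> (x - d) \<le> 1"])
    fix T x assume x: "x \<in> ?L" and "|T| <o |?L|" and TC: "group_closure T \<subseteq> C"
    then have card: "|T| <o \<Gamma>" using card_lp_space[OF \<Gamma>] ordLess_ordLeq_trans by blast
    show "\<exists>g\<in>UNIV. group_closure (insert g T) \<subseteq> C \<and>
      (\<exists>d\<in>group_closure (insert g T). lp_norm p \<Gamma> (x - d) \<le> 1)"
    proof (cases "\<exists>d\<in>group_closure T. lp_norm p \<Gamma> (x - d) \<le> 1")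
      case True
      \<comment> \<open>The generator 0 leaves the group unchanged.\<close>
      then show ?thesis using TC by (intro bexI[of _ 0]) auto
    next
      case far: False
      have TL: "T \<subseteq> ?L" using TC by (auto simp: C_def intro: group_closure.base)
      have nat: "|UNIV :: nat set| <o \<Gamma>" using uncountable_if_cexp_natLeq[OF \<Gamma>] .
      have finS: "|{x}| <o \<Gamma>"
        using nat card_of_singl_ordLeq[of "UNIV :: nat set" x] ordLeq_ordLess_trans by blast
      have "|T \<union> {x}| <o \<Gamma>"
        using Un_Cinfinite_bound_strict[OF card finS] \<Gamma> by (simp add: cinfinite_def)
      then obtain j where j: "j \<in> Field \<Gamma>" "\<And>y. y \<in> T \<union> {x} \<Longrightarrow> y j = 0"
      proof (rule exists_fresh_coordinate[OF \<Gamma>(1) nat])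
        show "countable {i. y i \<noteq> 0}" if "y \<in> T \<union> {x}" for y
          using that x TL countable_support_lp_space by blast
      qed blast
      have dj: "d j = 0" if "d \<in> group_closure T" for d
        using that by induction (use j in auto)
      define c :: "int \<Rightarrow> 'g \<Rightarrow> real" where "c n = (\<lambda>i. of_int n * (x i + of_bool (i = j)))" for n
      have c: "c (m - n) = c m - c n" for m n
        by (auto simp: c_def algebra_simps)
      have "z \<in> C" if z: "z \<in> group_closure (insert (c 1) T)" for z
      proof -
        obtain d n where d: "d \<in> group_closure T" and zd: "z = d + c n"
          using group_closure_insertE[OF z c refl] by metis
        have dL: "d \<in> ?L" using d TC by (auto simp: C_def)
        \<comment> \<open>\<open>y\<close> is \<open>z\<close> with its coordinate \<open>j\<close>
          erased, because \<open>d\<close> and \<open>x\<close> vanish there.\<close>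
        define y where "y = d + (\<lambda>i. of_int n * x i)"
        have yL: "y \<in> ?L" unfolding y_def using x dL p lp_space_scale lp_space_add by fastforce
        have y0: "y j = 0" using dj[OF d] j by (simp add: y_def)
        have zy: "z = y + (\<lambda>i. of_int n * of_bool (i = j))"
          by (auto simp: zd y_def c_def algebra_simps)
        have zL: "z \<in> ?L"
          unfolding zy using yL lp_space_scale[OF lp_space_unit_vector[OF j(1)]] p lp_space_add by fastforce
        have Sz: "S z = S y + \<bar>of_int n\<bar> powr p"
          unfolding S_def zy using infsum_powr_add_unit[OF yL j(1) y0] by simp
        consider "n = 0" | "\<bar>n\<bar> = 1" | "\<bar>n\<bar> \<ge> 2" by linarith
        then show ?thesis
        proof cases
          case 1
          then have "c n = 0" by (auto simp: c_def)
          then show ?thesis using zd d TC by auto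
        next
          case 2
          then have n: "n = 1 \<or> n = -1" by auto
          \<comment> \<open>Up to sign, \<open>y\<close> is the difference of \<open>x\<close> and a
            group element, so \<open>far\<close> gives \<open>S y > 1\<close>; the coordinate
            \<open>j\<close> contributes a further 1.\<close>
          have "\<exists>d'\<in>group_closure T. S (x - d') = S y"
          proof (cases "n = 1")
            case True
            then show ?thesis using d
              by (intro bexI[of _ "- d"]) (auto simp: S_def y_def add.commute)
          next
            case False
            then show ?thesis using d n
              by (intro bexI[of _ d]) (auto simp: S_def y_def abs_minus_commute)
          qed
          then obtain d' where d': "d' \<in> group_closure T" "S (x - d') = S y" by blast
          then have "\<not> S y powr (1 / p) \<le> 1" using far norm_S by metis
          then have "S y > 1" using powr_le1[of "1 / p" "S y"] S_ge0 p by force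
          then show ?thesis using Sz 2 zL by (simp add: C_def flip: of_int_abs)
        next
          case 3
          then have n2: "(2 :: real) \<le> \<bar>of_int n\<bar>" by linarith
          have "(2 :: real) powr p \<le> \<bar>of_int n\<bar> powr p"
            using n2 p by (intro powr_mono2) auto
          moreover have "(2 :: real) powr 1 \<le> 2 powr p" using p by (intro powr_mono) auto
          \<comment> \<open>Here strict separation uses \<open>p > 1\<close>: the coordinate
            \<open>j\<close> alone contributes at least \<open>2 powr p\<close>.\<close>
          moreover have "(2 :: real) powr 1 < 2 powr p" if "p > 1" using that by (intro powr_less_mono) auto
          ultimately show ?thesis using Sz S_ge0[of y] zL by (auto simp: C_def)
        qed
      qed
      moreover have "lp_norm p \<Gamma> (x - c 1) \<le> 1"
      proof -
        have 0: "(\<lambda>_. 0) \<in> ?L" by (simp add: lp_space_def)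
        \<comment> \<open>The difference is minus the unit vector at \<open>j\<close>.\<close>
        have "S (x - c 1) = 1"
          using infsum_powr_add_unit[OF 0 j(1), of 1] by (simp add: S_def c_def)
        then show ?thesis by (simp add: norm_S)
      qed
      ultimately show ?thesis
        by (intro bexI[of _ "c 1"]) (auto intro!: bexI[of _ "c 1"] group_closure.base)
    qed
  qed (use \<open>0 \<in> C\<close> in auto)
  let ?D = "group_closure T"
  have diff: "d - h \<in> C" if "d \<in> ?D" "h \<in> ?D" for d h
    using T(1) that group_closure.diff by blast
  show ?thesis
  proof
    show "add_subgroup ?L ?D"
      using T(1) by (intro add_subgroup_group_closure) (auto simp: C_def)
    show "separated (lp_norm p \<Gamma>) (2 powr (1 / p)) ?D"
      unfolding separated_def norm_S using diff p by (fastforce simp: C_def intro!: powr_mono2)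
    show "separated_plus (lp_norm p \<Gamma>) (2 powr (1 / p)) ?D" if "p > 1"
      unfolding separated_plus_def norm_S using diff that by (fastforce simp: C_def intro!: powr_less_mono2)
    show "dense_within (lp_norm p \<Gamma>) ?L 1 ?D"
      using T(2) by (simp add: dense_within_def)
  qed
qed

section \<open>Infinite-dimensional normed spaces\<close>

text \<open>If \<open>v\<close> has positive distance from the closed span, the norm of a vector
  controls its coefficient at \<open>v\<close>. Along a convergent sequence these coefficients are
  therefore Cauchy, and the limit splits accordingly.\<close>

lemma closed_span_insert:
  fixes v :: "'a::real_normed_vector"
  assumes "closed (span S)"
  shows "closed (span (insert v S))"
proof (cases "v \<in> span S")
  case True
  then show ?thesis using assms by (simp add: span_redundant)
next
  case False
  let ?d = "infdist v (span S)"
  have d: "?d > 0"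
    using False assms infdist_pos_not_in_closed[of "span S" v] span_zero[of S] by blast
  have bound: "\<bar>t\<bar> * ?d \<le> norm (y + t *\<^sub>R v)" if "y \<in> span S" for y t
  proof (cases "t = 0")
    case False
    have "?d \<le> dist v (- (1 / t) *\<^sub>R y)"
      using that by (intro infdist_le span_scale)
    also have "\<dots> = norm (y + t *\<^sub>R v) / \<bar>t\<bar>"
    proof -
      have "v - (- (1 / t) *\<^sub>R y) = (1 / t) *\<^sub>R (y + t *\<^sub>R v)"
        using False by (simp add: scaleR_right_distrib)
      then show ?thesis by (simp add: dist_norm)
    qed
    finally show ?thesis using False by (simp add: field_simps)
  qed simp
  show ?thesis
    unfolding closed_sequential_limits
  proof (intro allI impI, elim conjE)
    fix x l assume x: "\<forall>n. x n \<in> span (insert v S)" and lim: "x \<longlonglongrightarrow> l"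
    then have "\<forall>n. \<exists>k. x n - k *\<^sub>R v \<in> span S"
      using span_breakdown_eq by blast
    then obtain k where k: "\<And>n. x n - k n *\<^sub>R v \<in> span S"
      by metis
    have dk: "\<bar>k m - k n\<bar> * ?d \<le> dist (x m) (x n)" for m n
      using bound[OF span_diff[OF k[of m] k[of n]], of "k m - k n"]
      by (simp add: dist_norm algebra_simps)
    have "Cauchy k"
      unfolding Cauchy_def
    proof (intro allI impI)
      fix e :: real assume "e > 0"
      then have "e * ?d > 0" using d by simp
      then obtain N where N: "\<And>m n. m \<ge> N \<Longrightarrow> n \<ge> N \<Longrightarrow> dist (x m) (x n) < e * ?d"
        using LIMSEQ_imp_Cauchy[OF lim] unfolding Cauchy_def by blast
      have "dist (k m) (k n) < e" if "m \<ge> N" "n \<ge> N" for m n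
      proof -
        have "\<bar>k m - k n\<bar> * ?d < e * ?d" using dk N[OF that] by (rule le_less_trans)
        then show ?thesis using d by (simp add: dist_real_def)
      qed
      then show "\<exists>M. \<forall>m\<ge>M. \<forall>n\<ge>M. dist (k m) (k n) < e" by blast
    qed
    then obtain k0 where "k \<longlonglongrightarrow> k0" using Cauchy_convergent convergent_def by blast
    then have "(\<lambda>n. x n - k n *\<^sub>R v) \<longlonglongrightarrow> l - k0 *\<^sub>R v"
      using lim by (intro tendsto_intros)
    then have "l - k0 *\<^sub>R v \<in> span S"
      by (rule closed_sequentially[OF assms k])
    then show "l \<in> span (insert v S)" using span_breakdown_eq by blast
  qed
qed

lemma closed_span_finite:
  fixes S :: "'a::real_normed_vector set"
  assumes "finite S"
  shows "closed (span S)"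
  using assms
proof induction
  case empty
  then show ?case by simp
next
  case (insert v S)
  then show ?case by (intro closed_span_insert)
qed

lemma subspace_closure:
  fixes S :: "'a::real_normed_vector set"
  assumes "subspace S"
  shows "subspace (closure S)"
  unfolding subspace_def
proof (intro conjI ballI allI)
  show "0 \<in> closure S" using subspace_0[OF assms] closure_subset by blast
  fix c x assume "x \<in> closure S"
  moreover have "(\<lambda>x. c *\<^sub>R x) ` closure S \<subseteq> closure S"
    using subspace_scale[OF assms] closure_subset
    by (intro image_closure_subset) (auto intro!: continuous_intros)
  ultimately show "c *\<^sub>R x \<in> closure S" by blast
next
  fix x y assume "x \<in> closure S" "y \<in> closure S"
  then obtain f g where "\<And>n. f n \<in> S" "f \<longlonglongrightarrow> x" "\<And>n. g n \<in> S" "g \<longlonglongrightarrow> y"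
    unfolding closure_sequential by blast
  then have "\<forall>n. f n + g n \<in> S" "(\<lambda>n. f n + g n) \<longlonglongrightarrow> x + y"
    using subspace_add[OF assms] by (auto intro: tendsto_add)
  then show "x + y \<in> closure S"
    unfolding closure_sequential by (intro exI[of _ "\<lambda>n. f n + g n"] conjI)
qed

text \<open>Normalized so that the distance to \<open>Y\<close> is at least exactly 1 and the norm
  carries the error: separation must be exact, while density has room for \<open>e\<close>. The
  vector \<open>u\<close> is \<open>v\<close> minus an almost nearest point of \<open>Y\<close>,
  divided by the distance.\<close>

lemma Riesz_lemma:
  fixes Y :: "'a::real_normed_vector set"
  assumes "subspace Y" "closed Y" "Y \<noteq> UNIV" "e > 0"
  obtains u where "norm u \<le> 1 + e" "\<And>y. y \<in> Y \<Longrightarrow> norm (u - y) \<ge> 1"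
proof -
  obtain v where v: "v \<notin> Y" using assms by blast
  have ne: "Y \<noteq> {}" using assms(1) subspace_0 by blast
  let ?d = "infdist v Y"
  have d: "?d > 0" using v assms ne infdist_pos_not_in_closed by blast
  have "?d < ?d * (1 + e)" using d assms(4) by simp
  then have "(INF y\<in>Y. dist v y) < ?d * (1 + e)"
    by (simp add: infdist_notempty[OF ne])
  then obtain y0 where y0: "y0 \<in> Y" "dist v y0 < ?d * (1 + e)"
    using cInf_lessD[of "dist v ` Y"] ne by auto
  define u where "u = (1 / ?d) *\<^sub>R (v - y0)"
  show ?thesis
  proof
    show "norm u \<le> 1 + e"
    proof -
      have "norm u = dist v y0 / ?d" using d by (simp add: u_def dist_norm)
      also have "\<dots> \<le> 1 + e" using y0(2) d by (simp add: pos_divide_le_eq mult.commute)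
      finally show ?thesis .
    qed
    fix y assume y: "y \<in> Y"
    have "?d \<le> dist v (y0 + ?d *\<^sub>R y)"
      using y y0 assms(1) by (intro infdist_le subspace_add subspace_scale)
    moreover have "u - y = (1 / ?d) *\<^sub>R (v - (y0 + ?d *\<^sub>R y))"
      using d by (simp add: u_def scaleR_right_diff_distrib scaleR_right_distrib)
    ultimately show "norm (u - y) \<ge> 1"
      using d by (simp add: dist_norm)
  qed
qed

section \<open>Small dense subsets\<close>

text \<open>The group is exhausted by stages \<open>G n\<close>, each consisting of the differences
  of the previous one. Stages increase because they contain 0, and squares and countable unions do
  not raise an infinite cardinality.\<close>

lemma card_group_closure:
  fixes S :: "'a::ab_group_add set"
  assumes "infinite S"
  shows "|group_closure S| \<le>o |S|"
proof -
  define G where "G n = ((\<lambda>A. (\<lambda>(s, t). s - t) ` (A \<times> A)) ^^ n) (insert 0 S)" for n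
  have G0: "G 0 = insert 0 S" and GS: "G (Suc n) = (\<lambda>(s, t). s - t) ` (G n \<times> G n)" for n
    by (simp_all add: G_def)
  have zero: "0 \<in> G n" for n
    by (induction n) (force simp: G0 GS)+
  have "G n \<subseteq> G (Suc n)" for n
    using zero[of n] by (force simp: GS)
  then have mono: "G m \<subseteq> G n" if "m \<le> n" for m n
    using that lift_Suc_mono_le by blast
  have "z \<in> (\<Union>n. G n)" if "z \<in> group_closure S" for z
    using that
  proof induction
    case (base s)
    then show ?case using G0 by blast
  next
    case (diff s t)
    then obtain m n where "s \<in> G m" "t \<in> G n" by blast
    then have "s \<in> G (max m n)" "t \<in> G (max m n)" using mono by (meson max.cobounded1 max.cobounded2 subsetD)+
    then have "s - t \<in> G (Suc (max m n))" by (auto simp: GS)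
    then show ?case by blast
  qed
  then have "|group_closure S| \<le>o |\<Union>n. G n|" by (intro card_of_mono1) blast
  moreover have card: "|G n| \<le>o |S|" for n
  proof (induction n)
    case 0
    have "|{0 :: 'a}| \<le>o |S|" using assms by (intro card_of_singl_ordLeq) auto
    then have "|S \<union> {0}| \<le>o |S|"
      using assms by (intro Un_Cinfinite_bound)
        (auto simp: cinfinite_def Field_card_of card_of_card_order_on card_of_mono1)
    then show ?case by (simp add: G0)
  next
    case (Suc n)
    have "|G (Suc n)| \<le>o |G n \<times> G n|" unfolding GS by (rule card_of_image)
    also have "|G n \<times> G n| \<le>o |S|"
      using assms Suc by (intro card_of_Sigma_ordLeq_infinite) auto
    finally show ?case .
  qed
  moreover have "|\<Union>n. G n| \<le>o |S|"
    using assms card by (intro card_of_UNION_ordLeq_infinite) (auto simp: infinite_iff_card_of_nat)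
  ultimately show ?thesis using ordLeq_transitive by blast
qed

text \<open>\<open>M\<close> is the rational span of \<open>K\<close>, which is no larger than the
  infinite set \<open>K\<close>. Its closure absorbs real scalars by continuity, hence is a closed
  subspace containing \<open>K\<close>.\<close>

lemma dense_subset_card_le:
  fixes K :: "'a::real_normed_vector set"
  assumes "infinite K" "closure (span K) = UNIV"
  obtains M :: "'a set" where "|M| \<le>o |K|" "closure M = UNIV"
proof -
  define R where "R = (\<lambda>(q, k). of_rat q *\<^sub>R k) ` ((UNIV :: rat set) \<times> K)"
  define M where "M = group_closure R"
  have KR: "K \<subseteq> R" by (force simp: R_def intro: image_eqI[where x = "(1, _)"])
  have "|UNIV :: rat set| \<le>o |K|"
    using assms(1) infinite_iff_card_of_nat card_of_ordLeq[of "UNIV :: rat set" "UNIV :: nat set"]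
      inj_to_nat ordLeq_transitive by blast
  then have "|(UNIV :: rat set) \<times> K| \<le>o |K|"
    using assms(1) by (intro card_of_Sigma_ordLeq_infinite) (auto simp: card_of_mono1)
  then have R: "|R| \<le>o |K|"
    unfolding R_def using card_of_image ordLeq_transitive by blast
  have "|M| \<le>o |R|"
    unfolding M_def using KR assms(1) infinite_super by (intro card_group_closure) blast
  then have card: "|M| \<le>o |K|" using R ordLeq_transitive by blast
  have scale_M: "of_rat q *\<^sub>R m \<in> M" if "m \<in> M" for q m
    using that unfolding M_def
  proof induction
    case (base s)
    show ?case
    proof (cases "s = 0")
      case False
      then obtain q' k where "s = of_rat q' *\<^sub>R k" "k \<in> K" using base unfolding R_def by auto
      then have "of_rat q *\<^sub>R s \<in> R"
        by (auto simp: R_def of_rat_mult intro!: image_eqI[where x = "(q * q', k)"])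
      then show ?thesis by (auto intro: group_closure.base)
    qed simp
  next
    case (diff s t)
    then show ?case by (auto simp: scaleR_right_diff_distrib intro: group_closure.diff)
  qed
  \<comment> \<open>Scalar multiplication of a fixed \<open>m\<close> is continuous and sends the
    dense set of rationals into \<open>M\<close>.\<close>
  have real_scale_M: "c *\<^sub>R m \<in> closure M" if "m \<in> M" for c m
  proof -
    have "(\<lambda>c. c *\<^sub>R m) ` closure \<rat> \<subseteq> closure M"
    proof (rule image_closure_subset)
      show "(\<lambda>c. c *\<^sub>R m) ` \<rat> \<subseteq> closure M"
        using scale_M[OF that] closure_subset by (auto elim!: Rats_cases)
    qed (auto intro!: continuous_intros)
    then show ?thesis by (auto simp: Rats_closure_real)
  qed
  have "subspace (closure M)"
    unfolding subspace_def
  proof (intro conjI ballI allI)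
    show "0 \<in> closure M" using closure_subset[of M] by (auto simp: M_def)
    fix c x assume "x \<in> closure M"
    moreover have "(\<lambda>x. c *\<^sub>R x) ` closure M \<subseteq> closure M"
      using real_scale_M by (intro image_closure_subset) (auto intro!: continuous_intros)
    ultimately show "c *\<^sub>R x \<in> closure M" by blast
  next
    fix x y assume "x \<in> closure M" "y \<in> closure M"
    then obtain f g where "\<And>n. f n \<in> M" "f \<longlonglongrightarrow> x" "\<And>n. g n \<in> M" "g \<longlonglongrightarrow> y"
      unfolding closure_sequential by blast
    then have "\<forall>n. f n + g n \<in> M" "(\<lambda>n. f n + g n) \<longlonglongrightarrow> x + y"
      by (auto simp: M_def intro: group_closure_add tendsto_add)
    then show "x + y \<in> closure M"
      unfolding closure_sequential by (intro exI[of _ "\<lambda>n. f n + g n"] conjI)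
  qed
  moreover have "K \<subseteq> closure M"
    using KR closure_subset[of M] by (auto simp: M_def intro: group_closure.base)
  ultimately have "closure (span K) \<subseteq> closure M"
    by (simp add: closure_minimal span_minimal)
  then have "closure M = UNIV" using assms(2) by blast
  then show ?thesis by (rule that[OF card])
qed

section \<open>From a ball to the whole space\<close>

text \<open>For \<open>y\<close> outside the ball, a group element within \<open>r - \<eta>\<close>
  of the radial projection of \<open>y\<close> is within \<open>norm y - \<eta>\<close> of
  \<open>y\<close>. Subtracting it and iterating reaches the ball after finitely many steps, and
  there 0 suffices.\<close>

lemma dense_if_approximates_ball:
  fixes D :: "'a::real_normed_vector set"
  assumes "add_subgroup UNIV D" "\<eta> > 0"
    and ball: "\<And>x. norm x \<le> r \<Longrightarrow> \<exists>d\<in>D. norm (x - d) \<le> r - \<eta>"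
    and "r \<ge> 0"
  shows "\<exists>d\<in>D. norm (y - d) \<le> r"
proof -
  have "\<exists>d\<in>D. norm (y - d) \<le> r" if "norm y \<le> r + real n * \<eta>" for n y
    using that
  proof (induction n arbitrary: y)
    case 0
    then show ?case using assms(1) by (intro bexI[of _ 0]) (auto simp: add_subgroup_def)
  next
    case (Suc n)
    show ?case
    proof (cases "norm y \<le> r")
      case True
      then show ?thesis using assms(1) by (intro bexI[of _ 0]) (auto simp: add_subgroup_def)
    next
      case False
      then have ny: "norm y > 0" using assms(4) by linarith
      define z where "z = (r / norm y) *\<^sub>R y"
      have "norm z \<le> r" using ny assms(4) by (simp add: z_def)
      then obtain s where s: "s \<in> D" "norm (z - s) \<le> r - \<eta>" using ball by blast
      have "y - z = (1 - r / norm y) *\<^sub>R y" by (simp add: z_def algebra_simps)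
      then have "norm (y - z) = \<bar>1 - r / norm y\<bar> * norm y" by simp
      also have "\<dots> = norm y - r"
        using False ny by (simp add: abs_if field_simps)
      finally have "norm (y - z) = norm y - r" .
      then have "norm (y - s) \<le> norm y - \<eta>"
        using norm_triangle_ineq[of "y - z" "z - s"] s by simp
      then have "norm (y - s) \<le> r + real n * \<eta>"
        using Suc.prems by (simp add: algebra_simps)
      then obtain d where "d \<in> D" "norm (y - s - d) \<le> r" using Suc.IH by blast
      then show ?thesis
        using s assms(1) by (intro bexI[of _ "s + d"]) (auto simp: add_subgroup_def diff_diff_add)
    qed
  qed
  moreover obtain n where "norm y - r \<le> real n * \<eta>"
    using assms(2) reals_Archimedean3 by (meson less_imp_le)
  ultimately show ?thesis by (smt (verit))
qed

lemma normed_space_subgroup: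
  assumes infdim: "infinite_dimensional (UNIV :: 'x::real_normed_vector set)" and "\<epsilon> > 0"
  obtains T :: "'x::real_normed_vector set" where "\<And>t. t \<in> T \<Longrightarrow> norm t \<le> 2 + \<epsilon>"
    "separated norm 1 (group_closure T)" "dense_within norm UNIV (1 + \<epsilon>) (group_closure T)"
proof -
  \<comment> \<open>Generators have norm at most \<open>(1 + 2 * \<eta>) + (1 + \<eta> / 2)\<close>,
    which is below \<open>2 + \<epsilon>\<close>.\<close>
  define \<eta> where "\<eta> = \<epsilon> / 4"
  have \<eta>: "\<eta> > 0" using assms by (simp add: \<eta>_def)
  \<comment> \<open>\<open>K\<close> has the least cardinality among sets with dense span, so any
    smaller set spans a subspace that is not dense. It is infinite because finite sets have closed
    spans.\<close>
  let ?R = "{|K| | K :: 'x set. closure (span K) = UNIV}"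
  have "?R \<noteq> {}" by (auto intro: exI[of _ UNIV])
  then obtain K :: "'x set" where K: "closure (span K) = UNIV"
    and min: "\<And>K' :: 'x set. closure (span K') = UNIV \<Longrightarrow> |K| \<le>o |K'|"
    using exists_minim_Card_order[of ?R] card_of_Card_order by blast
  have infK: "infinite K"
  proof
    assume "finite K"
    then have "span K = UNIV" using K closed_span_finite[of K] by simp
    then show False using infdim \<open>finite K\<close> unfolding infinite_dimensional_def by blast
  qed
  obtain M where M: "|M| \<le>o |K|" "closure M = (UNIV :: 'x set)"
    using dense_subset_card_le[OF infK K] .
  define X where "X = {m \<in> M. norm m \<le> 1 + 2 * \<eta>}"
  have XK: "|X| \<le>o |K|"
    using M(1) card_of_mono1[of X M] ordLeq_transitive unfolding X_def by blast
  define C where "C = {z :: 'x. z = 0 \<or> norm z \<ge> 1}"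
  define B where "B = {z :: 'x. norm z \<le> 2 + \<epsilon>}"
  have "0 \<in> C" by (simp add: C_def)
  obtain T where T: "T \<subseteq> B" "group_closure T \<subseteq> C"
    "\<And>x. x \<in> X \<Longrightarrow> \<exists>d\<in>group_closure T. norm (x - d) \<le> 1 + \<eta> / 2"
  proof (rule transfinite_generators[of C X B "\<lambda>x d. norm (x - d) \<le> 1 + \<eta> / 2"])
    fix T x assume x: "x \<in> X" and "|T| <o |X|" and TC: "group_closure T \<subseteq> C"
    then have "|T| <o |K|" using XK ordLess_ordLeq_trans by blast
    moreover have "|{x}| <o |K|"
      using infK by (intro finite_ordLess_infinite) (auto simp: Field_card_of card_of_well_order_on)
    ultimately have "|T \<union> {x}| <o |K|"
      using infK by (intro Un_Cinfinite_bound_strict)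
        (auto simp: cinfinite_def Field_card_of card_of_card_order_on)
    \<comment> \<open>Minimality of \<open>K\<close> leaves room for Riesz' lemma at every
      stage.\<close>
    then have "closure (span (T \<union> {x})) \<noteq> UNIV" using min not_ordLess_ordLeq by blast
    moreover define Y where "Y = closure (span (T \<union> {x}))"
    ultimately have "Y \<noteq> UNIV" by simp
    moreover have Y: "subspace Y" unfolding Y_def by (intro subspace_closure subspace_span)
    moreover have "closed Y" by (simp add: Y_def)
    ultimately obtain u where u: "norm u \<le> 1 + \<eta> / 2" "\<And>y. y \<in> Y \<Longrightarrow> norm (u - y) \<ge> 1"
      using Riesz_lemma[of Y "\<eta> / 2"] \<eta> by auto
    have TY: "T \<union> {x} \<subseteq> Y"
      unfolding Y_def by (rule subset_trans[OF span_superset closure_subset])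
    have dY: "d \<in> Y" if "d \<in> group_closure T" for d
      using that by induction (use TY Y in \<open>auto intro: subspace_0 subspace_diff\<close>)
    have "z \<in> C" if z: "z \<in> group_closure (insert (x + u) T)" for z
    proof -
      obtain d n where d: "d \<in> group_closure T" and zd: "z = d + of_int n *\<^sub>R (x + u)"
        by (rule group_closure_insertE[OF z, of "\<lambda>n. of_int n *\<^sub>R (x + u)"])
          (auto simp: scaleR_left_diff_distrib)
      show ?thesis
      proof (cases "n = 0")
        case True
        then show ?thesis using zd d TC by auto
      next
        case False
        \<comment> \<open>Factoring out \<open>n\<close> turns \<open>z\<close> into
          \<open>n\<close> times the difference of \<open>u\<close> and a point of \<open>Y\<close>,
          whose norm is at least \<open>\<bar>n\<bar>\<close>.\<close>
        define y where "y = - ((1 / of_int n) *\<^sub>R d + x)"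
        have "y \<in> Y"
          unfolding y_def using dY[OF d] TY Y by (intro subspace_neg subspace_add subspace_scale) auto
        then have "1 \<le> norm (u - y)" using u by blast
        moreover have "1 \<le> \<bar>of_int n :: real\<bar>" using False by linarith
        ultimately have "1 * 1 \<le> \<bar>of_int n\<bar> * norm (u - y)" by (intro mult_mono) auto
        moreover have "z = of_int n *\<^sub>R (u - y)"
          using False by (simp add: zd y_def algebra_simps)
        ultimately show ?thesis by (simp add: C_def)
      qed
    qed
    moreover have "x + u \<in> B"
      using x u(1) norm_triangle_ineq[of x u] \<eta> by (simp add: B_def X_def \<eta>_def)
    moreover have "norm (x - (x + u)) \<le> 1 + \<eta> / 2" using u(1) by simp
    ultimately show "\<exists>g\<in>B. group_closure (insert g T) \<subseteq> C \<and>
        (\<exists>d\<in>group_closure (insert g T). norm (x - d) \<le> 1 + \<eta> / 2)"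
      by (intro bexI[of _ "x + u"]) (auto intro!: bexI[of _ "x + u"] group_closure.base)
  qed (use \<open>0 \<in> C\<close> in auto)
  let ?D = "group_closure T"
  have D: "add_subgroup UNIV ?D" by (intro add_subgroup_group_closure) simp
  \<comment> \<open>Replacing \<open>y\<close> by a point of \<open>M\<close> costs less than
    \<open>\<eta> / 4\<close> and stays inside the larger ball defining \<open>X\<close>. The total
    error is below \<open>1 + 3 * \<eta> / 4\<close>, a gain of \<open>\<eta> / 4\<close> over the
    radius.\<close>
  have ball: "\<exists>d\<in>?D. norm (y - d) \<le> (1 + \<eta>) - \<eta> / 4" if "norm y \<le> 1 + \<eta>" for y
  proof -
    obtain m where m: "m \<in> M" "dist m y < \<eta> / 4"
      using M(2) \<eta> closure_approachable[of y M] by (metis UNIV_I divide_pos_pos zero_less_numeral)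
    have "norm m \<le> norm y + norm (m - y)" using norm_triangle_ineq[of y "m - y"] by simp
    then have "m \<in> X" using m that \<eta> by (simp add: X_def dist_norm)
    then obtain d where "d \<in> ?D" "norm (m - d) \<le> 1 + \<eta> / 2" using T(3) by blast
    moreover have "norm (y - d) \<le> norm (m - y) + norm (m - d)"
      using norm_triangle_ineq[of "y - m" "m - d"] by (simp add: norm_minus_commute)
    ultimately show ?thesis using m by (intro bexI[of _ d]) (auto simp: dist_norm)
  qed
  show ?thesis
  proof
    show "norm t \<le> 2 + \<epsilon>" if "t \<in> T" for t using T(1) that by (auto simp: B_def)
    show "separated norm 1 ?D"
      unfolding separated_def
    proof (intro ballI impI)
      fix d h assume "d \<in> ?D" "h \<in> ?D" "d \<noteq> h"
      then have "d - h \<in> C" "d - h \<noteq> 0" using T(2) group_closure.diff by auto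
      then show "1 \<le> norm (d - h)" by (simp add: C_def)
    qed
    show "dense_within norm UNIV (1 + \<epsilon>) ?D"
      unfolding dense_within_def
    proof
      fix y :: 'x
      have "\<exists>d\<in>?D. norm (y - d) \<le> 1 + \<eta>"
        by (rule dense_if_approximates_ball[OF D _ ball]) (use \<eta> in auto)
      then show "\<exists>d\<in>?D. norm (y - d) \<le> 1 + \<epsilon>"
        using assms(2) by (force simp: \<eta>_def)
    qed
  qed
qed

theorem theorem3:
  shows "(\<forall>(\<Gamma>::'g rel) (p::real).
            Card_order \<Gamma> \<and> infinite (Field \<Gamma>) \<and> \<Gamma> ^c natLeq =o \<Gamma> \<and> 1 \<le> p \<longrightarrow>
              (\<exists>D. add_subgroup (lp_space p \<Gamma>) D \<and>
                   separated (lp_norm p \<Gamma>) (2 powr (1 / p)) D \<and>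
                   dense_within (lp_norm p \<Gamma>) (lp_space p \<Gamma>) 1 D) \<and>
              (p > 1 \<longrightarrow>
                (\<exists>D. add_subgroup (lp_space p \<Gamma>) D \<and>
                     separated_plus (lp_norm p \<Gamma>) (2 powr (1 / p)) D \<and>
                     dense_within (lp_norm p \<Gamma>) (lp_space p \<Gamma>) 1 D))) \<and>
         (infinite_dimensional (UNIV :: 'x::real_normed_vector set) \<longrightarrow>
            (\<forall>\<epsilon>>0. \<exists>D::'x set.
               add_subgroup UNIV D \<and>
               separated norm 1 D \<and>
               dense_within norm UNIV (1 + \<epsilon>) D \<and>
               (\<exists>S. D = group_closure S \<and> (\<forall>s\<in>S. norm s \<le> 2 + \<epsilon>))))"
proof (intro conjI allI impI; (elim conjE)?)
  fix \<Gamma> :: "'g rel" and p :: real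
  assume A: "Card_order \<Gamma>" "infinite (Field \<Gamma>)" "\<Gamma> ^c natLeq =o \<Gamma>" "1 \<le> p"
  then show "\<exists>D. add_subgroup (lp_space p \<Gamma>) D \<and> separated (lp_norm p \<Gamma>) (2 powr (1 / p)) D \<and>
      dense_within (lp_norm p \<Gamma>) (lp_space p \<Gamma>) 1 D"
    by (metis lp_subgroup)
  show "\<exists>D. add_subgroup (lp_space p \<Gamma>) D \<and> separated_plus (lp_norm p \<Gamma>) (2 powr (1 / p)) D \<and>
      dense_within (lp_norm p \<Gamma>) (lp_space p \<Gamma>) 1 D" if "p > 1"
    using A that by (metis lp_subgroup)
next
  fix \<epsilon> :: real
  assume "infinite_dimensional (UNIV :: 'x set)" "0 < \<epsilon>"
  then obtain T :: "'x set" where T: "\<And>t. t \<in> T \<Longrightarrow> norm t \<le> 2 + \<epsilon>"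
    "separated norm 1 (group_closure T)" "dense_within norm UNIV (1 + \<epsilon>) (group_closure T)"
    by (rule normed_space_subgroup) blast
  moreover have "add_subgroup UNIV (group_closure T)"
    by (intro add_subgroup_group_closure) simp
  ultimately show "\<exists>D::'x set. add_subgroup UNIV D \<and> separated norm 1 D \<and>
      dense_within norm UNIV (1 + \<epsilon>) D \<and> (\<exists>S. D = group_closure S \<and> (\<forall>s\<in>S. norm s \<le> 2 + \<epsilon>))"
    by blast
qed

end
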